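(* There exist interpolating Blaschke products (which therefore satisfy the Weak Embedding Property (WEP)) which do not satisfy the Sharp Invertibility Property (SIP).
   Context: $H^\infty$ is the algebra of bounded analytic functions on the open unit disc $\mathbb{D}$ with the sup norm $\|\cdot\|_\infty$. A Blaschke product is interpolating if its zeros $\{a_k\}$ are simple and form an interpolating sequence for $H^\infty$ (for every bounded sequence $(w_k)$ there is $f\in H^\infty$ with $f(a_k)=w_k$ for all $k$); equivalently (Carleson), $\inf_k\prod_{j\ne k}\rho(a_j,a_k)>0$, where $\rho(z,w)=|z-w|/|1-\bar wz|$. For an inner function $\Theta$ with zero set $\mathcal{Z}(\Theta)\subset\mathbb{D}$, $H^\infty/\Theta H^\infty$ has the norm $\|[f]\|=\inf\{\|f+g\Theta\|_\infty:g\in H^\infty\}$. WEP: for every $f\in H^\infty$, $\inf_{\mathcal{Z}(\Theta)}|f|>0$ implies that $[f]$ is invertible in $H^\infty/\Theta H^\infty$. SIP: for every $\varepsilon>0$ there exists $\delta>0$ such that for every $f\in H^\infty$, the conditions $\|[f]\|\le1$ and $\inf_{\mathcal{Z}(\Theta)}|f|\ge1-\delta$ imply that $[f]$ is invertible in $H^\infty/\Theta H^\infty$ and $\|[f]^{-1}\|\le1+\varepsilon$. *)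

theory Defs
  imports "HOL-Complex_Analysis.Complex_Analysis"
begin

abbreviation unit_disc :: "complex set" where
  "unit_disc \<equiv> ball 0 1"

text \<open>Elements of $H^\infty$ are represented by total functions; only their values on the
  disc matter, and all equalities below are required on the disc only.\<close>

definition Hinf :: "(complex \<Rightarrow> complex) set" where
  "Hinf = {f. f holomorphic_on unit_disc \<and> bounded (f ` unit_disc)}"

definition Hinf_norm :: "(complex \<Rightarrow> complex) \<Rightarrow> real" where
  "Hinf_norm f = (SUP z\<in>unit_disc. cmod (f z))"

definition blaschke_factor :: "complex \<Rightarrow> complex \<Rightarrow> complex" where
  "blaschke_factor a z =
     (if a = 0 then z else (of_real (cmod a) / a) * ((a - z) / (1 - cnj a * z)))"

text \<open>\<open>B\<close> is, up to a unimodular constant, the Blaschke product whose zeros, repeated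
  according to multiplicity, are the \<open>a k\<close> with \<open>k \<in> I\<close>. The index set allows both finite and
  infinite products.\<close>

definition blaschke_product_with_zeros ::
    "nat set \<Rightarrow> (nat \<Rightarrow> complex) \<Rightarrow> (complex \<Rightarrow> complex) \<Rightarrow> bool" where
  "blaschke_product_with_zeros I a B \<longleftrightarrow>
     (\<forall>k\<in>I. a k \<in> unit_disc) \<and>
     summable (\<lambda>k. if k \<in> I then 1 - cmod (a k) else 0) \<and>
     (\<exists>c. cmod c = 1 \<and>
        (\<forall>z\<in>unit_disc. B z = c * (\<Prod>k. if k \<in> I then blaschke_factor (a k) z else 1)))"

definition interpolating_sequence :: "nat set \<Rightarrow> (nat \<Rightarrow> complex) \<Rightarrow> bool" where
  "interpolating_sequence I a \<longleftrightarrow>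
     (\<forall>w :: nat \<Rightarrow> complex. bounded (w ` I) \<longrightarrow> (\<exists>f\<in>Hinf. \<forall>k\<in>I. f (a k) = w k))"

text \<open>Since zeros are listed with multiplicity, injectivity of the zero sequence says that the
  zeros are simple.\<close>

definition interpolating_blaschke_product :: "(complex \<Rightarrow> complex) \<Rightarrow> bool" where
  "interpolating_blaschke_product B \<longleftrightarrow>
     (\<exists>I a. blaschke_product_with_zeros I a B \<and> inj_on a I \<and> interpolating_sequence I a)"

definition zero_set :: "(complex \<Rightarrow> complex) \<Rightarrow> complex set" where
  "zero_set \<Theta> = {z \<in> unit_disc. \<Theta> z = 0}"

text \<open>The quotient $H^\infty / \Theta H^\infty$ is handled through representatives:
  \<open>quot_eq \<Theta> f g\<close> means $[f] = [g]$, and \<open>quot_norm \<Theta> f\<close> is the norm of $[f]$. The notions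
  are meant for inner \<open>\<Theta>\<close>, and only boundedness and holomorphy of \<open>\<Theta>\<close> matter for them to make
  sense.\<close>

definition quot_eq ::
    "(complex \<Rightarrow> complex) \<Rightarrow> (complex \<Rightarrow> complex) \<Rightarrow> (complex \<Rightarrow> complex) \<Rightarrow> bool" where
  "quot_eq \<Theta> f g \<longleftrightarrow> (\<exists>h\<in>Hinf. \<forall>z\<in>unit_disc. f z - g z = h z * \<Theta> z)"

definition quot_norm :: "(complex \<Rightarrow> complex) \<Rightarrow> (complex \<Rightarrow> complex) \<Rightarrow> real" where
  "quot_norm \<Theta> f = (INF g\<in>Hinf. Hinf_norm (\<lambda>z. f z + g z * \<Theta> z))"

text \<open>\<open>g\<close> represents the inverse of $[f]$, a class that is unique when it exists.\<close>

definition quot_inverse ::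
    "(complex \<Rightarrow> complex) \<Rightarrow> (complex \<Rightarrow> complex) \<Rightarrow> (complex \<Rightarrow> complex) \<Rightarrow> bool" where
  "quot_inverse \<Theta> f g \<longleftrightarrow> g \<in> Hinf \<and> quot_eq \<Theta> (\<lambda>z. f z * g z) (\<lambda>z. 1)"

text \<open>The infima are taken in the extended reals, so that the infimum over an empty zero set
  is \<open>\<infinity>\<close>.\<close>

definition WEP :: "(complex \<Rightarrow> complex) \<Rightarrow> bool" where
  "WEP \<Theta> \<longleftrightarrow>
     (\<forall>f\<in>Hinf. (INF z\<in>zero_set \<Theta>. ereal (cmod (f z))) > 0 \<longrightarrow> (\<exists>g. quot_inverse \<Theta> f g))"

definition SIP :: "(complex \<Rightarrow> complex) \<Rightarrow> bool" where
  "SIP \<Theta> \<longleftrightarrow>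
     (\<forall>\<epsilon>>0. \<exists>\<delta>>0. \<forall>f\<in>Hinf.
        quot_norm \<Theta> f \<le> 1 \<and> (INF z\<in>zero_set \<Theta>. ereal (cmod (f z))) \<ge> ereal (1 - \<delta>) \<longrightarrow>
        (\<exists>g. quot_inverse \<Theta> f g \<and> quot_norm \<Theta> g \<le> 1 + \<epsilon>))"

end

theory Submission
  imports Defs
begin

text \<open>A bounded holomorphic function that vanishes at the zeros of a Blaschke product \<open>B\<close> with
  simple zeros is divisible by \<open>B\<close> without increase of the sup norm (Schwarz lemma for finite
  products, then Montel). If the zeros \<open>a k\<close> form an interpolating sequence, apply this to
  \<open>f g - 1\<close>, where \<open>g\<close> interpolates \<open>1 / f (a k)\<close>; this gives the WEP.

  For the counterexample pass to the right half-plane via \<open>s = (1 + z) / (1 - z)\<close> and take the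
  zeros \<open>1 + \<i> k\<close>, \<open>k = 0, 1, 2, \<dots>\<close>, on a horocycle. The function \<open>f = exp (- \<delta> s)\<close> has norm at
  most 1 and modulus \<open>exp (- \<delta>) \<ge> 1 - \<delta>\<close> at all the zeros. If \<open>G\<close> of norm \<open>M\<close> represents an
  inverse of \<open>[f]\<close>, then \<open>f G - 1 = q B\<close> with \<open>\<bar>q\<bar> \<le> 1 + M\<close>. As \<open>s \<rightarrow> \<infinity>\<close> along the real axis,
  \<open>f G \<rightarrow> 0\<close> while \<open>\<bar>B\<bar>\<close> stays below \<open>0.46\<close>, so \<open>M \<ge> 1 / 0.46 - 1 > 1.17\<close> for every \<open>\<delta>\<close>.\<close>

subsection \<open>Division by Blaschke products\<close>

text \<open>A uniform bound is the only compactness input, and it survives in the limit with the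
  same constant. This is what carries norm estimates from finite to infinite products, and from
  finite interpolation sums to their limit.\<close>

lemma Montel_disc:
  fixes F :: "nat \<Rightarrow> complex \<Rightarrow> complex"
  assumes hol: "\<And>n. F n holomorphic_on unit_disc"
    and bound: "\<And>n z. z \<in> unit_disc \<Longrightarrow> cmod (F n z) \<le> K"
  obtains g r where "g holomorphic_on unit_disc" "strict_mono (r :: nat \<Rightarrow> nat)"
    "\<And>z. z \<in> unit_disc \<Longrightarrow> (\<lambda>n. F (r n) z) \<longlonglongrightarrow> g z"
    "\<And>z. z \<in> unit_disc \<Longrightarrow> cmod (g z) \<le> K"
proof -
  obtain g r where g: "g holomorphic_on unit_disc" "strict_mono (r :: nat \<Rightarrow> nat)"
    "\<And>z. z \<in> unit_disc \<Longrightarrow> (\<lambda>n. F (r n) z) \<longlonglongrightarrow> g z"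
  proof (rule Montel[of unit_disc "range F" F])
    show "open unit_disc" by simp
    show "h holomorphic_on unit_disc" if "h \<in> range F" for h using that hol by auto
    show "\<exists>B. \<forall>h\<in>range F. \<forall>z\<in>C. cmod (h z) \<le> B" if "compact C" "C \<subseteq> unit_disc" for C
      using that bound by blast
  qed auto
  have "cmod (g z) \<le> K" if "z \<in> unit_disc" for z
    using g(3)[OF that] bound[OF that] by (intro Lim_norm_ubound[of sequentially]) auto
  with g that show ?thesis by blast
qed

section \<open>Single Blaschke factors and division by finitely many of them\<close>

lemma one_minus_cnj_mult_nonzero:
  assumes "cmod a < 1" "cmod z < 1"
  shows "1 - cnj a * z \<noteq> 0"
proof
  assume "1 - cnj a * z = 0"
  then have "cmod (cnj a * z) = 1" by (metis norm_one right_minus_eq)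
  moreover have "cmod a * cmod z < 1"
    using assms mult_strict_mono[of "cmod a" 1 "cmod z" 1] by (cases "a = 0") auto
  ultimately show False by (simp add: norm_mult)
qed

text \<open>Reduces questions about moduli and holomorphy to known facts about disc
  automorphisms.\<close>

lemma blaschke_factor_Moebius:
  obtains u where "cmod u = 1" "\<And>z. blaschke_factor a z = u * Moebius_function 0 a z"
proof (cases "a = 0")
  case True
  then show ?thesis by (intro that[of 1]) (auto simp: blaschke_factor_def Moebius_function_simple)
next
  case False
  have "(of_real (cmod a) / a) * ((a - z) / (1 - cnj a * z)) =
      - (of_real (cmod a) / a) * ((z - a) / (1 - cnj a * z))" for z
    by (metis minus_diff_eq minus_divide_left minus_mult_commute)
  with False show ?thesis
    by (intro that[of "- (of_real (cmod a) / a)"])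
      (auto simp: blaschke_factor_def Moebius_function_simple norm_divide)
qed

lemma norm_blaschke_factor:
  "cmod (blaschke_factor a z) = cmod ((a - z) / (1 - cnj a * z))"
  by (rule blaschke_factor_Moebius[of a])
    (simp add: norm_mult norm_divide Moebius_function_simple norm_minus_commute)

lemma norm_blaschke_factor_le_1:
  assumes "cmod a < 1" "cmod z < 1"
  shows "cmod (blaschke_factor a z) \<le> 1"
  using Moebius_function_norm_lt_1[OF assms, of 0]
  by (rule_tac blaschke_factor_Moebius[of a]) (auto simp: norm_mult)

lemma blaschke_factor_eq_0_iff:
  assumes "cmod a < 1" "cmod z < 1"
  shows "blaschke_factor a z = 0 \<longleftrightarrow> z = a"
  using one_minus_cnj_mult_nonzero[OF assms]
  by (auto simp flip: norm_eq_zero[of "blaschke_factor a z"] simp: norm_blaschke_factor norm_divide)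

lemma blaschke_factor_holomorphic:
  assumes "cmod a < 1"
  shows "blaschke_factor a holomorphic_on unit_disc"
proof -
  obtain u where "blaschke_factor a = (\<lambda>z. u * Moebius_function 0 a z)"
    using blaschke_factor_Moebius[of a] by metis
  then show ?thesis
    using Moebius_function_holomorphic[OF assms] by (auto intro!: holomorphic_intros)
qed

text \<open>With b = |a|/a one has 1 - \<open>blaschke_factor a z\<close> = (1 - |a|) (1 + b z) / (1
  - cnj a z). The factor 1 - |a| turns the Blaschke condition into absolute convergence of the
  product at every point z.\<close>

lemma norm_one_minus_blaschke_factor_le:
  assumes "cmod a < 1" "cmod z < 1"
  shows "cmod (blaschke_factor a z - 1) \<le> (1 - cmod a) * (2 / (1 - cmod z))"
proof (cases "a = 0")
  case True
  have "cmod (z - 1) \<le> 2" using norm_triangle_ineq4[of z 1] assms by simp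
  also have "2 \<le> 2 / (1 - cmod z)" using assms by (simp add: field_simps)
  finally show ?thesis using True by (simp add: blaschke_factor_def)
next
  case False
  define b where "b = of_real (cmod a) / a"
  have b: "cmod b = 1" using False by (simp add: b_def norm_divide)
  have ba: "b * a = of_real (cmod a)" using False by (simp add: b_def)
  have cb: "cnj a = of_real (cmod a) * b"
    using False by (simp add: b_def field_simps complex_norm_square power2_eq_square)
      (metis complex_norm_square power2_eq_square mult.commute of_real_mult)
  have nz: "1 - cnj a * z \<noteq> 0" using one_minus_cnj_mult_nonzero assms by blast
  have "blaschke_factor a z - 1 = (b * (a - z) - (1 - cnj a * z)) / (1 - cnj a * z)"
    using False nz by (simp add: blaschke_factor_def b_def field_simps)
  also have "b * (a - z) - (1 - cnj a * z) = - (1 - of_real (cmod a)) * (1 + b * z)"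
    using ba cb by (simp add: algebra_simps)
  finally have "cmod (blaschke_factor a z - 1) =
      cmod (1 - of_real (cmod a)) * (cmod (1 + b * z) / cmod (1 - cnj a * z))"
    by (simp add: norm_mult norm_divide del: minus_diff_eq)
  moreover have "cmod (1 - of_real (cmod a)) = 1 - cmod a"
    using assms norm_of_real[of "1 - cmod a", where 'a = complex] by simp
  ultimately have eq: "cmod (blaschke_factor a z - 1) =
      (1 - cmod a) * (cmod (1 + b * z) / cmod (1 - cnj a * z))"
    by simp
  have "cmod (1 + b * z) \<le> 2"
    using norm_triangle_ineq[of 1 "b * z"] assms by (simp add: norm_mult b)
  moreover have "1 - cmod z \<le> cmod (1 - cnj a * z)"
  proof -
    have "cmod a * cmod z \<le> 1 * cmod z" using assms by (intro mult_right_mono) auto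
    then show ?thesis using norm_triangle_ineq2[of 1 "cnj a * z"] by (simp add: norm_mult)
  qed
  ultimately have "cmod (1 + b * z) / cmod (1 - cnj a * z) \<le> 2 / (1 - cmod z)"
    using assms by (intro frac_le) auto
  then show ?thesis unfolding eq using assms by (intro mult_left_mono) auto
qed

lemma norm_le_Moebius:
  assumes hol: "h holomorphic_on unit_disc" and bound: "\<And>z. z \<in> unit_disc \<Longrightarrow> cmod (h z) \<le> K"
    and a: "cmod a < 1" "h a = 0" and z: "cmod z < 1"
  shows "cmod (h z) \<le> K * cmod (Moebius_function 0 a z)"
proof -
  \<comment> \<open>The Schwarz lemma asks for values strictly inside the disc, so h, moved so that
    its zero lies at 0, is divided by some L > K. Letting L tend to K then gives the claim.\<close>
  have *: "cmod (h z) \<le> L * cmod (Moebius_function 0 a z)" if "L > K" for L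
  proof -
    have "0 \<le> K" using bound[of a] a by simp
    then have L: "L > 0" using that by simp
    define f where "f = (\<lambda>w. h (Moebius_function 0 (- a) w) / of_real L)"
    have M: "Moebius_function 0 (- a) w \<in> unit_disc" if "cmod w < 1" for w
      using Moebius_function_norm_lt_1[of "- a" w 0] a that by simp
    have "(h \<circ> Moebius_function 0 (- a)) holomorphic_on unit_disc"
      using Moebius_function_holomorphic[of "- a" 0] a M
      by (intro holomorphic_on_compose_gen[OF _ hol]) auto
    then have "f holomorphic_on unit_disc"
      unfolding f_def o_def using L by (intro holomorphic_intros) auto
    moreover have "f 0 = 0" by (simp add: f_def Moebius_function_simple a)
    moreover have "cmod (f w) < 1" if "cmod w < 1" for w
      using bound[OF M[OF that]] \<open>L > K\<close> L by (simp add: f_def norm_divide)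
    moreover have "cmod (Moebius_function 0 a z) < 1"
      using Moebius_function_norm_lt_1 a z by blast
    ultimately have "cmod (f (Moebius_function 0 a z)) \<le> cmod (Moebius_function 0 a z)"
      by (rule Schwarz_Lemma)
    moreover have "Moebius_function 0 (- a) (Moebius_function 0 a z) = z"
      using a z by (intro Moebius_function_compose) auto
    ultimately show ?thesis using L by (simp add: f_def norm_divide field_simps)
  qed
  have "((\<lambda>L. L * cmod (Moebius_function 0 a z)) \<longlongrightarrow> K * cmod (Moebius_function 0 a z)) (at_right K)"
    by (intro tendsto_intros)
  moreover have "\<forall>\<^sub>F L in at_right K. cmod (h z) \<le> L * cmod (Moebius_function 0 a z)"
    using * by (auto simp: eventually_at_right_field intro: exI[of _ "K + 1"])
  ultimately show ?thesis by (intro tendsto_lowerbound) auto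
qed

lemma divide_blaschke_factor:
  assumes hol: "h holomorphic_on unit_disc" and bound: "\<And>z. z \<in> unit_disc \<Longrightarrow> cmod (h z) \<le> K"
    and a: "cmod a < 1" "h a = 0"
  obtains q where "q holomorphic_on unit_disc" "\<And>z. z \<in> unit_disc \<Longrightarrow> cmod (q z) \<le> K"
    "\<And>z. z \<in> unit_disc \<Longrightarrow> h z = q z * blaschke_factor a z"
proof -
  obtain u where u: "cmod u = 1" "\<And>z. blaschke_factor a z = u * Moebius_function 0 a z"
    using blaschke_factor_Moebius by blast
  have u0: "u \<noteq> 0" using u(1) by auto
  \<comment> \<open>As h a = 0, this is h divided by the Blaschke factor, with the removable
    singularity at a filled in.\<close>
  define q where "q = (\<lambda>z. (if z = a then deriv h a else (h z - h a) / (z - a)) * ((1 - cnj a * z) / u))"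
  have qhol: "q holomorphic_on unit_disc"
    unfolding q_def using u0
    by (intro holomorphic_on_mult pole_lemma_open hol holomorphic_intros) auto
  have heq: "h z = q z * blaschke_factor a z" if "z \<in> unit_disc" for z
    using that a u0 one_minus_cnj_mult_nonzero[of a z]
    by (auto simp: q_def u Moebius_function_simple)
  have qb: "cmod (q z) \<le> K" if "z \<in> unit_disc" "z \<noteq> a" for z
  proof -
    have "cmod (q z) * cmod (Moebius_function 0 a z) \<le> K * cmod (Moebius_function 0 a z)"
      using norm_le_Moebius[OF hol bound a, of z] heq[OF that(1)] that u by (simp add: norm_mult)
    moreover have "cmod (Moebius_function 0 a z) > 0"
      using that a one_minus_cnj_mult_nonzero[of a z] by (simp add: Moebius_function_simple)
    ultimately show ?thesis by simp
  qed
  \<comment> \<open>At a itself the Schwarz estimate only says 0 \<le> 0; the bound there comes from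
    continuity.\<close>
  have "cmod (q a) \<le> K"
  proof (rule Lim_norm_ubound[of "at a" q])
    show "(q \<longlongrightarrow> q a) (at a)"
      using holomorphic_on_imp_continuous_on[OF qhol] a
      by (simp add: continuous_on_eq_continuous_at isContD)
    have "\<forall>\<^sub>F z in at a. z \<in> unit_disc - {a}"
      using a eventually_at_in_open[of unit_disc a] by simp
    then show "\<forall>\<^sub>F z in at a. cmod (q z) \<le> K" by eventually_elim (use qb in auto)
  qed auto
  with qb qhol heq that show ?thesis by metis
qed

lemma divide_finite_blaschke_product:
  fixes I :: "nat set"
  assumes hol: "h holomorphic_on unit_disc" and bound: "\<And>z. z \<in> unit_disc \<Longrightarrow> cmod (h z) \<le> K"
    and a: "\<And>k. k \<in> I \<Longrightarrow> cmod (a k) < 1" "\<And>k. k \<in> I \<Longrightarrow> h (a k) = 0" and inj: "inj_on a I"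
  shows "\<exists>q. q holomorphic_on unit_disc \<and> (\<forall>z\<in>unit_disc. cmod (q z) \<le> K) \<and>
    (\<forall>z\<in>unit_disc. h z = q z * (\<Prod>k<n. if k \<in> I then blaschke_factor (a k) z else 1))"
proof (induction n)
  case 0
  then show ?case using hol bound by auto
next
  case (Suc n)
  then obtain q where q: "q holomorphic_on unit_disc" "\<And>z. z \<in> unit_disc \<Longrightarrow> cmod (q z) \<le> K"
    "\<And>z. z \<in> unit_disc \<Longrightarrow> h z = q z * (\<Prod>k<n. if k \<in> I then blaschke_factor (a k) z else 1)"
    by blast
  show ?case
  proof (cases "n \<in> I")
    case True
    \<comment> \<open>The zeros are distinct, so no earlier factor vanishes at \<open>a n\<close>;
      the zero of h there must be a zero of the quotient q.\<close>
    have "(if k \<in> I then blaschke_factor (a k) (a n) else 1) \<noteq> 0" if "k < n" for k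
      using that True a(1) inj by (auto simp: blaschke_factor_eq_0_iff inj_on_def)
    then have "(\<Prod>k<n. if k \<in> I then blaschke_factor (a k) (a n) else 1) \<noteq> 0" by auto
    then have "q (a n) = 0" using q(3)[of "a n"] a True by auto
    from divide_blaschke_factor[OF q(1,2) a(1)[OF True] this]
    obtain q' where "q' holomorphic_on unit_disc" "\<And>z. z \<in> unit_disc \<Longrightarrow> cmod (q' z) \<le> K"
      "\<And>z. z \<in> unit_disc \<Longrightarrow> q z = q' z * blaschke_factor (a n) z" by blast
    with q(3) True show ?thesis by (intro exI[of _ q']) (auto simp: mult_ac)
  next
    case False
    with q show ?thesis by auto
  qed
qed

section \<open>Infinite Blaschke products\<close>

context
  fixes I :: "nat set" and a :: "nat \<Rightarrow> complex" and B :: "complex \<Rightarrow> complex"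
  assumes B: "blaschke_product_with_zeros I a B"
begin

lemma zeros_in_disc: "k \<in> I \<Longrightarrow> cmod (a k) < 1"
  using B by (simp add: blaschke_product_with_zeros_def)

lemma convergent_prod_blaschke_factors:
  assumes z: "z \<in> unit_disc"
  shows "convergent_prod (\<lambda>k. if k \<in> I then blaschke_factor (a k) z else 1)"
proof (intro abs_convergent_prod_imp_convergent_prod summable_imp_abs_convergent_prod)
  have "summable (\<lambda>k. (if k \<in> I then 1 - cmod (a k) else 0) * (2 / (1 - cmod z)))"
    using B by (intro summable_mult2) (simp add: blaschke_product_with_zeros_def)
  then show "summable (\<lambda>k. cmod ((if k \<in> I then blaschke_factor (a k) z else 1) - 1))"
    by (rule summable_comparison_test'[of _ 0])
      (use norm_one_minus_blaschke_factor_le[OF zeros_in_disc, of _ z] z in auto)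
qed

lemma blaschke_product_LIMSEQ:
  obtains c where "cmod c = 1"
    "\<And>z. z \<in> unit_disc \<Longrightarrow>
      (\<lambda>n. c * (\<Prod>k<n. if k \<in> I then blaschke_factor (a k) z else 1)) \<longlonglongrightarrow> B z"
proof -
  obtain c where c: "cmod c = 1"
    "\<And>z. z \<in> unit_disc \<Longrightarrow> B z = c * (\<Prod>k. if k \<in> I then blaschke_factor (a k) z else 1)"
    using B by (auto simp: blaschke_product_with_zeros_def)
  have "(\<lambda>n. c * (\<Prod>k<n. if k \<in> I then blaschke_factor (a k) z else 1)) \<longlonglongrightarrow> B z"
    if "z \<in> unit_disc" for z
    unfolding c(2)[OF that]
    using convergent_prod_LIMSEQ[OF convergent_prod_blaschke_factors[OF that]]
    by (intro tendsto_intros) (simp add: lessThan_Suc_atMost LIMSEQ_lessThan_iff_atMost)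
  with c that show ?thesis by blast
qed

text \<open>Every factor has modulus at most 1, so the moduli of the partial products decrease to
  that of B. A suitable choice of n yields the bound 1, the vanishing at the zeros, and later the
  quantitative estimate for the counterexample.\<close>

lemma norm_blaschke_product_le:
  assumes "z \<in> unit_disc"
  shows "cmod (B z) \<le> (\<Prod>k<n. if k \<in> I then cmod (blaschke_factor (a k) z) else 1)"
proof -
  obtain c where c: "cmod c = 1"
    "(\<lambda>n. c * (\<Prod>k<n. if k \<in> I then blaschke_factor (a k) z else 1)) \<longlonglongrightarrow> B z"
    using blaschke_product_LIMSEQ assms by metis
  have "(\<lambda>n. \<Prod>k<n. if k \<in> I then cmod (blaschke_factor (a k) z) else 1) \<longlonglongrightarrow> cmod (B z)"
    using tendsto_norm[OF c(2)]
    by (simp add: norm_mult c(1) flip: prod_norm cong: if_cong)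
      (simp add: if_distrib[of cmod] cong: if_cong)
  moreover have "decseq (\<lambda>n. \<Prod>k<n. if k \<in> I then cmod (blaschke_factor (a k) z) else 1)"
    using assms zeros_in_disc
    by (intro decseq_SucI) (auto intro!: mult_right_le_one_le prod_nonneg norm_blaschke_factor_le_1)
  ultimately show ?thesis by (rule decseq_ge[rotated])
qed

lemma zero_set_blaschke_product: "zero_set B = a ` I"
proof (intro equalityI subsetI)
  fix z assume z: "z \<in> zero_set B"
  then have z': "z \<in> unit_disc" "B z = 0" by (auto simp: zero_set_def)
  obtain c where "cmod c = 1" "B z = c * (\<Prod>k. if k \<in> I then blaschke_factor (a k) z else 1)"
    using B z' by (auto simp: blaschke_product_with_zeros_def)
  then have "(\<Prod>k. if k \<in> I then blaschke_factor (a k) z else 1) = 0" using z' by auto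
  \<comment> \<open>A convergent infinite product vanishes only if one of its factors does.\<close>
  then obtain k where "(if k \<in> I then blaschke_factor (a k) z else 1) = 0"
    using prodinf_nonzero[OF convergent_prod_blaschke_factors[OF z'(1)]] by blast
  then show "z \<in> a ` I" using z' zeros_in_disc by (auto simp: blaschke_factor_eq_0_iff split: if_splits)
next
  fix z assume "z \<in> a ` I"
  then obtain k where k: "k \<in> I" "z = a k" by blast
  then have z: "z \<in> unit_disc" using zeros_in_disc by auto
  have "cmod (B z) \<le> (\<Prod>j<Suc k. if j \<in> I then cmod (blaschke_factor (a j) z) else 1)"
    by (rule norm_blaschke_product_le[OF z])
  also have "\<dots> = 0" using k z by (auto simp: blaschke_factor_eq_0_iff)
  finally show "z \<in> zero_set B" using z by (simp add: zero_set_def)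
qed

lemma norm_blaschke_product_le_1: "z \<in> unit_disc \<Longrightarrow> cmod (B z) \<le> 1"
  using norm_blaschke_product_le[of z 0] by simp

text \<open>The partial products converge pointwise to B and are bounded by 1. Montel supplies a
  holomorphic limit along a subsequence, which must be B.\<close>

lemma blaschke_product_holomorphic: "B holomorphic_on unit_disc"
proof -
  obtain c where c: "cmod c = 1" "\<And>z. z \<in> unit_disc \<Longrightarrow>
      (\<lambda>n. c * (\<Prod>k<n. if k \<in> I then blaschke_factor (a k) z else 1)) \<longlonglongrightarrow> B z"
    using blaschke_product_LIMSEQ by metis
  define F where "F = (\<lambda>n z. c * (\<Prod>k<n. if k \<in> I then blaschke_factor (a k) z else 1))"
  have "(\<lambda>z. if k \<in> I then blaschke_factor (a k) z else 1) holomorphic_on unit_disc" for k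
    using blaschke_factor_holomorphic[OF zeros_in_disc] by (cases "k \<in> I") auto
  then have hol: "F n holomorphic_on unit_disc" for n
    unfolding F_def by (intro holomorphic_intros)
  have bound: "cmod (F n z) \<le> 1" if "z \<in> unit_disc" for n z
    unfolding F_def norm_mult c(1) prod_norm[symmetric] using that zeros_in_disc
    by (auto intro!: prod_le_1 norm_blaschke_factor_le_1)
  from Montel_disc[of F, OF hol bound]
  obtain g r where g: "g holomorphic_on unit_disc" "strict_mono (r :: nat \<Rightarrow> nat)"
    "\<And>z. z \<in> unit_disc \<Longrightarrow> (\<lambda>n. F (r n) z) \<longlonglongrightarrow> g z"
    "\<And>z. z \<in> unit_disc \<Longrightarrow> cmod (g z) \<le> 1"
    by blast
  have "g z = B z" if "z \<in> unit_disc" for z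
  proof (rule LIMSEQ_unique[OF g(3)[OF that]])
    show "(\<lambda>n. F (r n) z) \<longlonglongrightarrow> B z"
      using LIMSEQ_subseq_LIMSEQ[OF c(2)[OF that] g(2)] by (simp add: F_def o_def)
  qed
  then show ?thesis using g(1) holomorphic_cong[of unit_disc unit_disc g B] by simp
qed

text \<open>The quotients of h by the partial products all obey the same bound K, so a subsequence
  converges; its limit, corrected by the unimodular constant c, is the quotient by B.\<close>

lemma divide_blaschke_product:
  assumes inj: "inj_on a I"
    and hol: "h holomorphic_on unit_disc" and bound: "\<And>z. z \<in> unit_disc \<Longrightarrow> cmod (h z) \<le> K"
    and h0: "\<And>k. k \<in> I \<Longrightarrow> h (a k) = 0"
  obtains q where "q holomorphic_on unit_disc" "\<And>z. z \<in> unit_disc \<Longrightarrow> cmod (q z) \<le> K"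
    "\<And>z. z \<in> unit_disc \<Longrightarrow> h z = q z * B z"
proof -
  obtain c where c: "cmod c = 1" "\<And>z. z \<in> unit_disc \<Longrightarrow>
      (\<lambda>n. c * (\<Prod>k<n. if k \<in> I then blaschke_factor (a k) z else 1)) \<longlonglongrightarrow> B z"
    using blaschke_product_LIMSEQ by metis
  have "\<exists>q. q holomorphic_on unit_disc \<and> (\<forall>z\<in>unit_disc. cmod (q z) \<le> K) \<and>
    (\<forall>z\<in>unit_disc. h z = q z * (\<Prod>k<n. if k \<in> I then blaschke_factor (a k) z else 1))" for n
    by (rule divide_finite_blaschke_product[OF hol bound zeros_in_disc h0 inj])
  then obtain Q where Q: "\<And>n. Q n holomorphic_on unit_disc"
    "\<And>n z. z \<in> unit_disc \<Longrightarrow> cmod (Q n z) \<le> K"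
    "\<And>n z. z \<in> unit_disc \<Longrightarrow>
      h z = Q n z * (\<Prod>k<n. if k \<in> I then blaschke_factor (a k) z else 1)"
    by metis
  obtain g r where g: "g holomorphic_on unit_disc" "strict_mono (r :: nat \<Rightarrow> nat)"
    "\<And>z. z \<in> unit_disc \<Longrightarrow> (\<lambda>n. Q (r n) z) \<longlonglongrightarrow> g z"
    "\<And>z. z \<in> unit_disc \<Longrightarrow> cmod (g z) \<le> K"
    using Montel_disc[of Q K] Q by blast
  have "c * h z = g z * B z" if "z \<in> unit_disc" for z
  proof -
    have "(\<lambda>n. Q (r n) z * (c * (\<Prod>k<r n. if k \<in> I then blaschke_factor (a k) z else 1))) \<longlonglongrightarrow> g z * B z"
      using LIMSEQ_subseq_LIMSEQ[OF c(2)[OF that] g(2)] g(3)[OF that]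
      by (intro tendsto_mult) (simp_all add: o_def)
    moreover have "Q (r n) z * (c * (\<Prod>k<r n. if k \<in> I then blaschke_factor (a k) z else 1)) = c * h z" for n
      using Q(3)[OF that, of "r n"] by simp
    ultimately show ?thesis using LIMSEQ_unique[OF tendsto_const] by simp
  qed
  moreover have "c \<noteq> 0" using c(1) by auto
  ultimately have "h z = g z / c * B z" if "z \<in> unit_disc" for z
    using that by (simp add: field_simps)
  moreover have "(\<lambda>z. g z / c) holomorphic_on unit_disc"
    using g(1) \<open>c \<noteq> 0\<close> by (intro holomorphic_intros) auto
  ultimately show ?thesis using g(4) c(1) by (intro that[of "\<lambda>z. g z / c"]) (auto simp: norm_divide)
qed

end

section \<open>Bounded analytic functions and the WEP\<close>

lemma Hinf_bounded:
  assumes "f \<in> Hinf"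
  obtains K where "\<And>z. z \<in> unit_disc \<Longrightarrow> cmod (f z) \<le> K"
  using assms unfolding Hinf_def bounded_iff by blast

lemma HinfI:
  assumes "f holomorphic_on unit_disc" "\<And>z. z \<in> unit_disc \<Longrightarrow> cmod (f z) \<le> K"
  shows "f \<in> Hinf"
  using assms unfolding Hinf_def bounded_iff by blast

lemma Hinf_add: "f \<in> Hinf \<Longrightarrow> g \<in> Hinf \<Longrightarrow> (\<lambda>z. f z + g z) \<in> Hinf"
  by (auto simp: Hinf_def intro!: holomorphic_intros bounded_plus_comp)

lemma Hinf_mult:
  assumes "f \<in> Hinf" "g \<in> Hinf"
  shows "(\<lambda>z. f z * g z) \<in> Hinf"
proof -
  obtain K L where "\<And>z. z \<in> unit_disc \<Longrightarrow> cmod (f z) \<le> K" "\<And>z. z \<in> unit_disc \<Longrightarrow> cmod (g z) \<le> L"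
    using assms Hinf_bounded by metis
  then show ?thesis using assms
    by (intro HinfI[where K = "K * L"])
      (auto simp: Hinf_def norm_mult intro!: holomorphic_intros mult_mono' )
qed

lemma interpolating_blaschke_product_WEP:
  assumes "interpolating_blaschke_product B"
  shows "WEP B"
  unfolding WEP_def
proof (intro ballI impI)
  fix f assume f: "f \<in> Hinf" and inf: "(INF z\<in>zero_set B. ereal (cmod (f z))) > 0"
  obtain I a where B: "blaschke_product_with_zeros I a B" and inj: "inj_on a I"
    and int: "interpolating_sequence I a"
    using assms by (auto simp: interpolating_blaschke_product_def)
  \<comment> \<open>The infimum is infinite when B has no zeros, so a real d strictly below it is
    taken.\<close>
  obtain d where d: "0 < ereal d" "ereal d < (INF z\<in>zero_set B. ereal (cmod (f z)))"
    using ereal_dense2[OF inf] by blast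
  have fa: "d \<le> cmod (f (a k))" if "k \<in> I" for k
  proof -
    have "a k \<in> zero_set B" using zero_set_blaschke_product[OF B] that by auto
    then have "ereal d < ereal (cmod (f (a k)))" using d(2) INF_lower less_le_trans by metis
    then show ?thesis by simp
  qed
  have "bounded ((\<lambda>k. 1 / f (a k)) ` I)"
    using fa d(1) by (auto simp: bounded_iff norm_divide intro!: exI[of _ "1 / d"] frac_le)
  then obtain g where g: "g \<in> Hinf" "\<And>k. k \<in> I \<Longrightarrow> g (a k) = 1 / f (a k)"
    using int by (auto simp: interpolating_sequence_def)
  define h where "h = (\<lambda>z. f z * g z + (- 1))"
  have h: "h \<in> Hinf"
    unfolding h_def by (intro Hinf_add Hinf_mult f g HinfI[of "\<lambda>_. - 1" 1]) auto
  then obtain K where K: "\<And>z. z \<in> unit_disc \<Longrightarrow> cmod (h z) \<le> K"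
    using Hinf_bounded by blast
  have zero: "h (a k) = 0" if "k \<in> I" for k
    using g(2)[OF that] fa[OF that] d(1) by (auto simp: h_def)
  have "h holomorphic_on unit_disc" using h by (simp add: Hinf_def)
  from divide_blaschke_product[OF B inj this K zero]
  obtain q where q: "q holomorphic_on unit_disc" "\<And>z. z \<in> unit_disc \<Longrightarrow> cmod (q z) \<le> K"
    "\<And>z. z \<in> unit_disc \<Longrightarrow> h z = q z * B z" by blast
  show "\<exists>g. quot_inverse B f g"
    unfolding quot_inverse_def quot_eq_def using g(1) HinfI[OF q(1,2)] q(3)
    by (intro exI[of _ g] conjI bexI[of _ q]) (auto simp: h_def)
qed

subsection \<open>Interpolation on a horocycle\<close>

definition cayley :: "complex \<Rightarrow> complex" where
  "cayley z = (1 + z) / (1 - z)"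

definition inv_cayley :: "complex \<Rightarrow> complex" where
  "inv_cayley s = (s - 1) / (s + 1)"

lemma Re_cayley_pos:
  assumes "z \<in> unit_disc"
  shows "0 < Re (cayley z)"
proof -
  have "z \<noteq> 1" using assms by auto
  have "(cmod z)\<^sup>2 < 1" using assms by (simp add: power_less_one_iff)
  then have "0 < 1 - (Re z)\<^sup>2 - (Im z)\<^sup>2" by (simp add: cmod_power2)
  moreover have "0 < (1 - Re z)\<^sup>2 + (Im z)\<^sup>2"
    using \<open>z \<noteq> 1\<close> by (auto simp: complex_eq_iff sum_power2_gt_zero_iff)
  ultimately show ?thesis
    by (simp add: cayley_def complex_div_gt_0 Re_divide power2_eq_square algebra_simps divide_pos_pos)
qed

lemma cayley_holomorphic: "cayley holomorphic_on unit_disc"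
proof -
  have "(\<lambda>z. (1 + z) / (1 - z)) holomorphic_on unit_disc"
    by (intro holomorphic_intros) auto
  then show ?thesis by (simp add: cayley_def[abs_def])
qed

lemma right_half_plane_add_1_nonzero: "0 < Re s \<Longrightarrow> s + 1 \<noteq> 0"
  by (auto simp: complex_eq_iff)

lemma cayley_inv_cayley:
  assumes "0 < Re s"
  shows "cayley (inv_cayley s) = s"
proof -
  have *: "s + 1 \<noteq> 0" using right_half_plane_add_1_nonzero[OF assms] .
  have "1 + inv_cayley s = 2 * s / (s + 1)" "1 - inv_cayley s = 2 / (s + 1)"
    using * by (simp_all add: inv_cayley_def field_simps)
  then show ?thesis using * by (simp add: cayley_def)
qed

text \<open>Positivity of the right side puts the image in the disc; at the nodes its value 4 / (4 +
  k^2) gives the Blaschke condition.\<close>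

lemma norm_inv_cayley_power2:
  assumes "0 < Re s"
  shows "1 - (cmod (inv_cayley s))\<^sup>2 = 4 * Re s / (cmod (s + 1))\<^sup>2"
proof -
  have *: "(cmod (s + 1))\<^sup>2 \<noteq> 0" using right_half_plane_add_1_nonzero[OF assms] by simp
  have "(cmod (s + 1))\<^sup>2 - (cmod (s - 1))\<^sup>2 = 4 * Re s"
    unfolding cmod_power2 by (simp add: power2_eq_square algebra_simps)
  then show ?thesis using * by (simp add: inv_cayley_def norm_divide power_divide field_simps)
qed

lemma inv_cayley_in_disc:
  assumes "0 < Re s"
  shows "cmod (inv_cayley s) < 1"
proof -
  have "0 < 4 * Re s / (cmod (s + 1))\<^sup>2"
    using right_half_plane_add_1_nonzero[OF assms] assms by simp
  then have "(cmod (inv_cayley s))\<^sup>2 < 1" using norm_inv_cayley_power2[OF assms] by simp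
  then show ?thesis by (simp add: power_less_one_iff abs_square_less_1)
qed

text \<open>Both sides are the pseudohyperbolic distance, in disc and in half-plane
  coordinates.\<close>

lemma norm_blaschke_factor_inv_cayley:
  assumes "0 < Re s" "0 < Re t"
  shows "cmod (blaschke_factor (inv_cayley s) (inv_cayley t)) = cmod (s - t) / cmod (cnj s + t)"
proof -
  have nz: "s + 1 \<noteq> 0" "t + 1 \<noteq> 0" "cnj s + 1 \<noteq> 0"
    using assms right_half_plane_add_1_nonzero[of "cnj s"] by (auto dest: right_half_plane_add_1_nonzero)
  have "inv_cayley s - inv_cayley t = 2 * (s - t) / ((s + 1) * (t + 1))"
    using nz by (simp add: inv_cayley_def divide_simps) (simp add: algebra_simps)
  moreover have "1 - cnj (inv_cayley s) * inv_cayley t = 2 * (cnj s + t) / ((cnj s + 1) * (t + 1))"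
    using nz by (simp add: inv_cayley_def divide_simps) (simp add: algebra_simps)
  moreover have "cmod (cnj s + 1) = cmod (s + 1)"
    by (metis complex_cnj_add complex_cnj_one complex_mod_cnj)
  ultimately show ?thesis
    using nz by (simp add: norm_blaschke_factor norm_divide norm_mult
        del: right_diff_distrib_numeral distrib_left_numeral)
qed

text \<open>The difference of arctangents is the integral of 1 / (1 + x^2) over [y, y + 1]. There
  x^2 \<le> (|y| + 1)^2 \<le> 2 y^2 + 2, whence the factor 3.\<close>

lemma inverse_one_plus_square_le_arctan_diff:
  fixes y :: real
  shows "1 / (1 + y\<^sup>2) \<le> 3 * (arctan (y + 1) - arctan y)"
proof -
  obtain x where x: "y < x" "x < y + 1" "arctan (y + 1) - arctan y = (y + 1 - y) * inverse (1 + x\<^sup>2)"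
    using MVT2[of y "y + 1" arctan "\<lambda>x. inverse (1 + x\<^sup>2)"] DERIV_arctan by auto
  have "x\<^sup>2 \<le> (\<bar>y\<bar> + 1)\<^sup>2" using x by (intro abs_le_square_iff[THEN iffD1]) auto
  also have "\<dots> \<le> 2 * y\<^sup>2 + 2"
    using zero_le_power2[of "\<bar>y\<bar> - 1"] by (simp add: power2_eq_square algebra_simps)
  finally have "1 + x\<^sup>2 \<le> 3 * (1 + y\<^sup>2)" using zero_le_power2[of y] by argo
  moreover have "0 < 1 + x\<^sup>2" "0 < 1 + y\<^sup>2" using zero_le_power2[of x] zero_le_power2[of y] by linarith+
  ultimately show ?thesis unfolding x(3) by (simp add: field_simps)
qed

text \<open>The arctangents telescope. Uniformity in t matters: t will be the imaginary part of an
  arbitrary point of the half-plane.\<close>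

lemma sum_inverse_one_plus_square_le:
  fixes t :: real
  shows "(\<Sum>k<n. 1 / (1 + (real k - t)\<^sup>2)) \<le> 3 * pi"
proof -
  have "(\<Sum>k<n. 1 / (1 + (real k - t)\<^sup>2)) \<le> (\<Sum>k<n. 3 * (arctan (real (Suc k) - t) - arctan (real k - t)))"
  proof (rule sum_mono)
    fix k
    have "real (Suc k) - t = real k - t + 1" by simp
    then show "1 / (1 + (real k - t)\<^sup>2) \<le> 3 * (arctan (real (Suc k) - t) - arctan (real k - t))"
      using inverse_one_plus_square_le_arctan_diff[of "real k - t"] by (simp only:)
  qed
  also have "\<dots> = 3 * (arctan (real n - t) - arctan (- t))"
    using sum_lessThan_telescope[of "\<lambda>k. arctan (real k - t)" n]
    by (simp only: sum_distrib_left[symmetric] of_nat_0 diff_0)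
  also have "\<dots> \<le> 3 * pi"
    using arctan_bounded[of "real n - t"] arctan_bounded[of "- t"] by simp
  finally show ?thesis .
qed

section \<open>The zeros of the counterexample and their Blaschke product\<close>

definition horocycle :: "nat \<Rightarrow> complex" where
  "horocycle k = Complex 1 (real k)"

text \<open>In the disc the line Re s = 1 becomes a circle tangent to the unit circle at 1, the
  image of infinity.\<close>

definition node :: "nat \<Rightarrow> complex" where
  "node k = inv_cayley (horocycle k)"

lemma node_in_disc: "node k \<in> unit_disc"
  by (simp add: node_def horocycle_def inv_cayley_in_disc)

lemma cayley_node: "cayley (node k) = horocycle k"
  by (simp add: node_def horocycle_def cayley_inv_cayley)

lemma inj_node: "inj node"
  by (rule inj_on_inverseI[where g = "\<lambda>z. nat \<lfloor>Im (cayley z)\<rfloor>"]) (simp add: cayley_node horocycle_def)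

lemma summable_one_minus_norm_node: "summable (\<lambda>k. 1 - cmod (node k))"
proof (rule summable_comparison_test'[of _ 0])
  have "summable (\<lambda>k. 1 / (1 + (real k)\<^sup>2))"
    using sum_inverse_one_plus_square_le[of 0] by (intro summableI_nonneg_bounded[where x = "3 * pi"]) auto
  then show "summable (\<lambda>k. 4 * (1 / (1 + (real k)\<^sup>2)))" by (rule summable_mult)
  fix k
  have n: "cmod (node k) < 1" using node_in_disc[of k] by simp
  then have "(cmod (node k))\<^sup>2 \<le> cmod (node k)"
    by (simp add: power2_eq_square mult_left_le)
  then have "1 - cmod (node k) \<le> 1 - (cmod (node k))\<^sup>2" by simp
  also have "\<dots> = 4 / (4 + (real k)\<^sup>2)"
    using norm_inv_cayley_power2[of "horocycle k"]
    by (simp add: node_def horocycle_def cmod_power2)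
  also have "\<dots> \<le> 4 * (1 / (1 + (real k)\<^sup>2))"
    by (simp add: add_pos_nonneg frac_le)
  finally show "norm (1 - cmod (node k)) \<le> 4 * (1 / (1 + (real k)\<^sup>2))" using n by simp
qed

definition node_blaschke :: "complex \<Rightarrow> complex" where
  "node_blaschke z = (\<Prod>k. blaschke_factor (node k) z)"

lemma blaschke_product_node_blaschke: "blaschke_product_with_zeros UNIV node node_blaschke"
  unfolding blaschke_product_with_zeros_def
  using node_in_disc summable_one_minus_norm_node
  by (auto simp: node_blaschke_def intro!: exI[of _ 1])

text \<open>An entire function with simple zeros at the points \<open>\<i> n\<close>, \<open>n \<noteq> 0\<close>. The square of its
  translate by \<open>horocycle k\<close> vanishes at all other points of the horocycle and decays
  quadratically along vertical lines, which makes Lagrange interpolation sums converge.\<close>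

definition exp_slope :: "complex \<Rightarrow> complex" where
  "exp_slope u = (if u = 0 then - 2 * of_real pi else (exp (- 2 * of_real pi * u) - 1) / u)"

text \<open>The value at 0 is the derivative of the exponential there, so the singularity is
  removed.\<close>

lemma exp_slope_holomorphic: "exp_slope holomorphic_on UNIV"
proof -
  define E where "E = (\<lambda>u. exp (- 2 * of_real pi * u) :: complex)"
  have "(E has_field_derivative - 2 * of_real pi) (at 0)"
    unfolding E_def by (auto intro!: derivative_eq_intros)
  then have "exp_slope = (\<lambda>u. if u = 0 then deriv E 0 else (E u - E 0) / (u - 0))"
    by (simp add: exp_slope_def E_def DERIV_imp_deriv fun_eq_iff)
  moreover have "E holomorphic_on UNIV" unfolding E_def by (intro holomorphic_intros)
  ultimately show ?thesis using pole_lemma_open[of E UNIV 0] by simp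
qed

lemma exp_slope_0: "exp_slope 0 \<noteq> 0"
  by (simp add: exp_slope_def)

lemma exp_slope_horocycle_diff:
  assumes "j \<noteq> k"
  shows "exp_slope (horocycle j - horocycle k) = 0"
proof -
  have "- 2 * of_real pi * (horocycle j - horocycle k) = of_int (2 * (int k - int j)) * (of_real pi * \<i>)"
    by (simp add: horocycle_def complex_eq_iff algebra_simps)
  then have "exp (- 2 * of_real pi * (horocycle j - horocycle k)) = 1"
    using exp_integer_2pi[of "of_int (int k - int j)"] by (simp add: mult_ac)
  then show ?thesis using assms by (simp add: exp_slope_def horocycle_def)
qed

text \<open>For Re u \<ge> -1 the exponential is at most exp (2 pi) in modulus, so |u|
  |\<open>exp_slope u\<close>| is bounded; near 0 compactness takes over. The half-plane Re u \<ge>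
  -1 contains every difference \<open>cayley z - horocycle k\<close> with z in the disc.\<close>

lemma exp_slope_bound:
  obtains A where "\<And>u. - 1 \<le> Re u \<Longrightarrow> (cmod (exp_slope u))\<^sup>2 \<le> A / (1 + (Im u)\<^sup>2)"
proof -
  have "compact (exp_slope ` cball 0 1)"
    using holomorphic_on_imp_continuous_on[OF exp_slope_holomorphic]
    by (intro compact_continuous_image) (auto intro: continuous_on_subset)
  then obtain K where K: "\<And>u. cmod u \<le> 1 \<Longrightarrow> cmod (exp_slope u) \<le> K"
    by (metis compact_imp_bounded bounded_iff imageI mem_cball_0)
  define L where "L = exp (2 * pi) + 1"
  have large: "cmod u * cmod (exp_slope u) \<le> L" if "- 1 \<le> Re u" for u
  proof (cases "u = 0")
    case False
    have "pi * Re u \<ge> pi * (- 1)" using that by (intro mult_left_mono) auto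
    then have "cmod (exp (- 2 * of_real pi * u)) \<le> exp (2 * pi)" by simp
    then have "cmod (exp (- 2 * of_real pi * u) - 1) \<le> L"
      using norm_triangle_ineq4[of "exp (- 2 * of_real pi * u)" 1]
      unfolding L_def norm_one by linarith
    then show ?thesis using False by (simp add: exp_slope_def norm_divide)
  qed (simp add: L_def add_nonneg_nonneg)
  have L: "0 \<le> L" by (simp add: L_def add_nonneg_nonneg)
  have K0: "0 \<le> K" using order_trans[OF norm_ge_zero K[of 0]] by simp
  have small: "cmod (exp_slope u) \<le> K + L" if "- 1 \<le> Re u" for u
  proof (cases "cmod u \<le> 1")
    case False
    then have "cmod (exp_slope u) \<le> cmod u * cmod (exp_slope u)"
      by (simp add: mult_le_cancel_right1)
    with large[OF that] K0 show ?thesis by linarith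
  qed (use K L in force)
  have "(cmod (exp_slope u))\<^sup>2 \<le> ((K + L)\<^sup>2 + L\<^sup>2) / (1 + (Im u)\<^sup>2)" if "- 1 \<le> Re u" for u
  proof -
    have "\<bar>Im u\<bar> * cmod (exp_slope u) \<le> L"
      using large[OF that] mult_right_mono[OF abs_Im_le_cmod[of u] norm_ge_zero] by (rule order_trans[rotated])
    then have "(\<bar>Im u\<bar> * cmod (exp_slope u))\<^sup>2 \<le> L\<^sup>2" by (intro power_mono) auto
    moreover have "(cmod (exp_slope u))\<^sup>2 \<le> (K + L)\<^sup>2" using small[OF that] by (intro power_mono) auto
    ultimately have "(cmod (exp_slope u))\<^sup>2 * (1 + (Im u)\<^sup>2) \<le> (K + L)\<^sup>2 + L\<^sup>2"
      by (simp add: power_mult_distrib algebra_simps)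
    then show ?thesis by (simp add: pos_le_divide_eq add_pos_nonneg)
  qed
  then show ?thesis using that by blast
qed

lemma interpolating_sequence_node: "interpolating_sequence UNIV node"
  unfolding interpolating_sequence_def
proof (intro allI impI)
  fix w :: "nat \<Rightarrow> complex" assume "bounded (range w)"
  then obtain W where W: "\<And>k. cmod (w k) \<le> W" by (auto simp: bounded_iff)
  have W0: "0 \<le> W" using order_trans[OF norm_ge_zero W[of 0]] by simp
  obtain A where A: "\<And>u. - 1 \<le> Re u \<Longrightarrow> (cmod (exp_slope u))\<^sup>2 \<le> A / (1 + (Im u)\<^sup>2)"
    using exp_slope_bound by blast
  have A0: "0 \<le> A" using order_trans[OF zero_le_power2 A[of 0]] by simp
  define c where "c = (exp_slope 0)\<^sup>2"
  have c: "c \<noteq> 0" using exp_slope_0 by (simp add: c_def)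
  \<comment> \<open>Division by c makes the k-th Lagrange function equal to 1 at
    \<open>node k\<close>. Once n > j, the value of the sum at \<open>node j\<close> no longer
    changes, so the Montel limit interpolates.\<close>
  define F where "F = (\<lambda>n z. \<Sum>k<n. w k * ((exp_slope (cayley z - horocycle k))\<^sup>2 / c))"
  have comp: "(\<lambda>z. exp_slope (cayley z - horocycle k)) holomorphic_on unit_disc" for k
  proof -
    have "exp_slope \<circ> (\<lambda>z. cayley z - horocycle k) holomorphic_on unit_disc"
      by (intro holomorphic_on_compose_gen[OF _ exp_slope_holomorphic] holomorphic_intros
          cayley_holomorphic) auto
    then show ?thesis by (simp add: o_def)
  qed
  have hol: "F n holomorphic_on unit_disc" for n
    unfolding F_def using c by (intro holomorphic_intros comp)
  have bound: "cmod (F n z) \<le> W * (A / cmod c) * (3 * pi)" if z: "z \<in> unit_disc" for n z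
  proof -
    have "cmod (F n z) \<le> (\<Sum>k<n. W * (A / cmod c) * (1 / (1 + (real k - Im (cayley z))\<^sup>2)))"
      unfolding F_def
    proof (rule sum_norm_le)
      fix k
      have "- 1 \<le> Re (cayley z - horocycle k)" using Re_cayley_pos[OF z] by (simp add: horocycle_def)
      from A[OF this]
      have "(cmod (exp_slope (cayley z - horocycle k)))\<^sup>2 \<le> A / (1 + (real k - Im (cayley z))\<^sup>2)"
        by (simp add: horocycle_def power2_commute)
      then have "cmod (w k) * ((cmod (exp_slope (cayley z - horocycle k)))\<^sup>2 / cmod c)
          \<le> W * (A / (1 + (real k - Im (cayley z))\<^sup>2) / cmod c)"
        using W W0 by (intro mult_mono divide_right_mono) auto
      then show "cmod (w k * ((exp_slope (cayley z - horocycle k))\<^sup>2 / c))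
          \<le> W * (A / cmod c) * (1 / (1 + (real k - Im (cayley z))\<^sup>2))"
        by (simp add: norm_mult norm_divide norm_power mult.commute)
    qed
    also have "\<dots> \<le> W * (A / cmod c) * (3 * pi)"
      unfolding sum_distrib_left[symmetric] using W0 A0 sum_inverse_one_plus_square_le
      by (intro mult_left_mono) auto
    finally show ?thesis .
  qed
  have val: "F n (node j) = w j" if "j < n" for n j
  proof -
    have "F n (node j) = (\<Sum>k<n. if k = j then w j else 0)"
      unfolding F_def using c by (intro sum.cong refl) (auto simp: cayley_node exp_slope_horocycle_diff c_def)
    then show ?thesis using that by simp
  qed
  from Montel_disc[of F, OF hol bound]
  obtain g r where g: "g holomorphic_on unit_disc" "strict_mono (r :: nat \<Rightarrow> nat)"
    "\<And>z. z \<in> unit_disc \<Longrightarrow> (\<lambda>n. F (r n) z) \<longlonglongrightarrow> g z"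
    "\<And>z. z \<in> unit_disc \<Longrightarrow> cmod (g z) \<le> W * (A / cmod c) * (3 * pi)"
    by blast
  have "g (node j) = w j" for j
  proof (rule LIMSEQ_unique[OF g(3)[OF node_in_disc]])
    have "\<forall>\<^sub>F n in sequentially. w j = F (r n) (node j)"
      using eventually_gt_at_top[of j]
      by eventually_elim (use val seq_suble[OF g(2)] less_le_trans in metis)
    then show "(\<lambda>n. F (r n) (node j)) \<longlonglongrightarrow> w j" by (rule tendsto_eventually[OF eventually_mono]) simp
  qed
  with HinfI[OF g(1,4)] show "\<exists>f\<in>Hinf. \<forall>k\<in>UNIV. f (node k) = w k" by blast
qed

lemma interpolating_node_blaschke: "interpolating_blaschke_product node_blaschke"
  unfolding interpolating_blaschke_product_def
  using blaschke_product_node_blaschke inj_node interpolating_sequence_node by blast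

subsection \<open>Failure of the sharp invertibility property\<close>

lemma norm_node_blaschke_le:
  assumes "8 \<le> m"
  shows "cmod (node_blaschke (inv_cayley (of_nat m))) \<le> 46 / 100"
proof -
  define x where "x = real m"
  have x: "8 \<le> x" using assms by (simp add: x_def)
  have z: "inv_cayley (of_nat m) \<in> unit_disc" using assms by (simp add: inv_cayley_in_disc)
  \<comment> \<open>The left side is 1 - 4 x / D with D = (1 + x)^2 + k^2. For k < x the leading
    part of D is at most 2 x^2, suggesting 2 / x; with 7/4 in place of 2, x \<ge> 8 suffices to
    absorb the lower-order terms, since D \<le> (16/7) x^2.\<close>
  have factor: "(cmod (blaschke_factor (node k) (inv_cayley (of_nat m))))\<^sup>2 \<le> 1 - (7 / 4) / x"
    if "k < m" for k
  proof -
    have "(cmod (blaschke_factor (node k) (inv_cayley (of_nat m))))\<^sup>2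
        = ((1 - x)\<^sup>2 + (real k)\<^sup>2) / ((1 + x)\<^sup>2 + (real k)\<^sup>2)"
      using assms unfolding node_def
      by (subst norm_blaschke_factor_inv_cayley)
        (auto simp: horocycle_def power_divide cmod_power2 x_def)
    also have "\<dots> \<le> 1 - (7 / 4) / x"
    proof -
      have "real k \<le> x" using that by (simp add: x_def)
      then have "(real k)\<^sup>2 \<le> x\<^sup>2" by (intro power_mono) auto
      moreover have "8 * x \<le> x\<^sup>2" using x by (simp add: power2_eq_square)
      moreover have "7 * ((1 + x)\<^sup>2 + (real k)\<^sup>2) = 7 + 14 * x + 7 * x\<^sup>2 + 7 * (real k)\<^sup>2"
        by (simp add: power2_eq_square algebra_simps)
      ultimately have "7 * ((1 + x)\<^sup>2 + (real k)\<^sup>2) \<le> 16 * x\<^sup>2"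
        using x by argo
      then have "(7 / 4) / x * ((1 + x)\<^sup>2 + (real k)\<^sup>2) \<le> 4 * x"
        using x by (simp add: field_simps power2_eq_square)
      then have "(1 - x)\<^sup>2 + (real k)\<^sup>2 \<le> (1 - (7 / 4) / x) * ((1 + x)\<^sup>2 + (real k)\<^sup>2)"
        by (simp add: power2_eq_square algebra_simps)
      moreover have "0 < (1 + x)\<^sup>2 + (real k)\<^sup>2" using x by (simp add: add_pos_nonneg)
      ultimately show ?thesis by (simp add: pos_divide_le_eq)
    qed
    finally show ?thesis .
  qed
  have "cmod (node_blaschke (inv_cayley (of_nat m))) \<le>
      (\<Prod>k<m. cmod (blaschke_factor (node k) (inv_cayley (of_nat m))))"
    using norm_blaschke_product_le[OF blaschke_product_node_blaschke z, of m] by simp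
  then have "(cmod (node_blaschke (inv_cayley (of_nat m))))\<^sup>2 \<le>
      (\<Prod>k<m. cmod (blaschke_factor (node k) (inv_cayley (of_nat m))))\<^sup>2"
    by (intro power_mono) auto
  also have "\<dots> \<le> (\<Prod>k<m. 1 - (7 / 4) / x)"
    unfolding prod_power_distrib using factor by (intro prod_mono) auto
  also have "\<dots> = (1 - (7 / 4) / real m) ^ m" by (simp add: x_def)
  also have "\<dots> \<le> exp (- (7 / 4))"
    using assms by (intro exp_ge_one_minus_x_over_n_power_n) auto
  \<comment> \<open>Splitting the exponent into quarters allows the rational bound exp (1/4) \<ge>
    5/4; and (4/5)^7 is just below 0.46^2.\<close>
  also have "\<dots> = inverse (exp (1 / 4) ^ 7)"
    by (simp add: exp_of_nat_mult[symmetric] exp_minus)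
  also have "\<dots> \<le> inverse ((5 / 4) ^ 7)"
    using exp_ge_add_one_self[of "1 / 4 :: real"] by (intro le_imp_inverse_le power_mono) auto
  also have "\<dots> \<le> (46 / 100)\<^sup>2" by (simp add: field_simps power2_eq_square)
  finally show ?thesis by (rule power2_le_imp_le) simp
qed

lemma Hinf_norm_bounds:
  assumes "f \<in> Hinf"
  shows "0 \<le> Hinf_norm f" "z \<in> unit_disc \<Longrightarrow> cmod (f z) \<le> Hinf_norm f"
proof -
  have bdd: "bdd_above ((\<lambda>z. cmod (f z)) ` unit_disc)"
    using Hinf_bounded[OF assms] by (metis bdd_aboveI2)
  then show *: "cmod (f z) \<le> Hinf_norm f" if "z \<in> unit_disc" for z
    unfolding Hinf_norm_def using that by (intro cSUP_upper)
  show "0 \<le> Hinf_norm f" using order_trans[OF norm_ge_zero *[of 0]] by simp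
qed

lemma not_SIP_node_blaschke: "\<not> SIP node_blaschke"
proof
  define B where "B = node_blaschke"
  note BP = blaschke_product_node_blaschke[folded B_def]
  have BH: "B \<in> Hinf"
    using blaschke_product_holomorphic[OF BP] norm_blaschke_product_le_1[OF BP] by (rule HinfI)
  assume "SIP node_blaschke"
  then have "SIP B" by (simp add: B_def)
  \<comment> \<open>The choice of 1/10 for epsilon stays below the threshold 1 / 0.46 - 1 - 1 =
    0.17... and leaves room for the losses below.\<close>
  then obtain \<delta> where \<delta>: "\<delta> > 0" "\<And>f. f \<in> Hinf \<Longrightarrow> quot_norm B f \<le> 1 \<Longrightarrow>
      ereal (1 - \<delta>) \<le> (INF z\<in>zero_set B. ereal (cmod (f z))) \<Longrightarrow>
      \<exists>g. quot_inverse B f g \<and> quot_norm B g \<le> 1 + 1 / 10"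
    unfolding SIP_def by (elim allE[of _ "1 / 10"]) auto
  define f where "f = (\<lambda>z. exp (- of_real \<delta> * cayley z))"
  have norm_f: "cmod (f z) = exp (- \<delta> * Re (cayley z))" for z by (simp add: f_def)
  have f_le: "cmod (f z) \<le> 1" if "z \<in> unit_disc" for z
    using Re_cayley_pos[OF that] \<delta>(1) by (simp add: norm_f)
  have fhol: "f holomorphic_on unit_disc"
    unfolding f_def by (intro holomorphic_intros cayley_holomorphic)
  have f: "f \<in> Hinf" using fhol f_le by (rule HinfI)
  have "quot_norm B f \<le> Hinf_norm (\<lambda>z. f z + 0 * B z)"
    unfolding quot_norm_def
  proof (rule cINF_lower)
    show "bdd_below ((\<lambda>g. Hinf_norm (\<lambda>z. f z + g z * B z)) ` Hinf)"
      by (intro bdd_belowI2[where m = 0] Hinf_norm_bounds Hinf_add Hinf_mult f BH)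
    show "(\<lambda>_. 0) \<in> Hinf" by (rule HinfI[where K = 0]) auto
  qed
  also have "\<dots> \<le> 1" unfolding Hinf_norm_def using f_le by (intro cSUP_least) auto
  finally have "quot_norm B f \<le> 1" .
  moreover have "ereal (1 - \<delta>) \<le> (INF z\<in>zero_set B. ereal (cmod (f z)))"
    unfolding zero_set_blaschke_product[OF BP]
    using exp_ge_add_one_self[of "- \<delta>"]
    by (intro INF_greatest) (auto simp: norm_f cayley_node horocycle_def)
  ultimately obtain g where g: "quot_inverse B f g" "quot_norm B g \<le> 1 + 1 / 10"
    using \<delta>(2)[OF f] by blast
  \<comment> \<open>The infimum defining the quotient norm need not be attained; the slack between
    1.1 and 1.15 yields an actual representative G.\<close>
  then have "quot_norm B g < 115 / 100" by simp
  moreover have "(\<lambda>k. Hinf_norm (\<lambda>z. g z + k z * B z)) ` Hinf \<noteq> {}" using BH by blast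
  ultimately have "\<exists>y\<in>(\<lambda>k. Hinf_norm (\<lambda>z. g z + k z * B z)) ` Hinf. y < 115 / 100"
    unfolding quot_norm_def by (intro cInf_lessD)
  then obtain k where k: "k \<in> Hinf" "Hinf_norm (\<lambda>z. g z + k z * B z) < 115 / 100" by blast
  obtain h where gH: "g \<in> Hinf" and h: "\<And>z. z \<in> unit_disc \<Longrightarrow> f z * g z - 1 = h z * B z"
    using g(1) unfolding quot_inverse_def quot_eq_def by blast
  define G where "G = (\<lambda>z. g z + k z * B z)"
  have GH: "G \<in> Hinf" unfolding G_def by (intro Hinf_add Hinf_mult gH k BH)
  have G: "cmod (G z) \<le> 115 / 100" if "z \<in> unit_disc" for z
    using Hinf_norm_bounds(2)[OF GH that] k(2) by (simp add: G_def)
  have B0: "B (node j) = 0" for j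
    using zero_set_blaschke_product[OF BP] by (auto simp: zero_set_def)
  have Hhol: "(\<lambda>z. f z * G z - 1) holomorphic_on unit_disc"
    using fhol GH by (intro holomorphic_intros) (auto simp: Hinf_def)
  have fG: "cmod (f z * G z) \<le> cmod (f z) * (115 / 100)" if "z \<in> unit_disc" for z
    unfolding norm_mult using G[OF that] by (rule mult_left_mono) simp
  have Hbound: "cmod (f z * G z - 1) \<le> 215 / 100" if "z \<in> unit_disc" for z
    using fG[OF that] f_le[OF that] norm_triangle_ineq4[of "f z * G z" 1] by simp
  have Hzero: "f (node j) * G (node j) - 1 = 0" for j
    using h[OF node_in_disc, of j] B0 by (simp add: G_def)
  \<comment> \<open>The cofactor h from \<open>quot_inverse\<close> comes without a norm bound.
    Dividing afresh by B gives q bounded by 2.15 = 1 + 1.15.\<close>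
  from divide_blaschke_product[OF BP inj_node Hhol Hbound Hzero]
  obtain q where q: "q holomorphic_on unit_disc"
    "\<And>z. z \<in> unit_disc \<Longrightarrow> cmod (q z) \<le> 215 / 100"
    "\<And>z. z \<in> unit_disc \<Longrightarrow> f z * G z - 1 = q z * B z" by blast
  have "(\<lambda>m. exp (- \<delta> * real m)) \<longlonglongrightarrow> 0"
    unfolding exp_of_nat2_mult using \<delta>(1) by (intro LIMSEQ_power_zero) simp
  then have "\<forall>\<^sub>F m in sequentially. exp (- \<delta> * real m) < 1 / 1000"
    by (rule order_tendstoD) simp
  then have "\<forall>\<^sub>F m in sequentially. 8 \<le> m \<and> exp (- \<delta> * real m) < 1 / 1000"
    using eventually_ge_at_top by (rule eventually_conj[rotated])
  then obtain m where m: "8 \<le> m" "exp (- \<delta> * real m) < 1 / 1000"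
    by (auto simp: eventually_sequentially)
  define z where "z = inv_cayley (of_nat m)"
  have z: "z \<in> unit_disc" "cayley z = of_nat m"
    using m(1) by (simp_all add: z_def inv_cayley_in_disc cayley_inv_cayley)
  have "cmod (f z) < 1 / 1000" using m(2) by (simp add: norm_f z(2))
  \<comment> \<open>The contradiction is 0.99885 \<le> 2.15 * 0.46 = 0.989.\<close>
  then have "1 - 115 / 100000 \<le> cmod (f z * G z - 1)"
    using fG[OF z(1)] norm_triangle_ineq3[of "f z * G z" 1] by simp
  also have "\<dots> = cmod (q z) * cmod (B z)" using q(3)[OF z(1)] by (simp add: norm_mult)
  also have "\<dots> \<le> 215 / 100 * (46 / 100)"
    using q(2)[OF z(1)] norm_node_blaschke_le[OF m(1)] by (intro mult_mono) (auto simp: B_def z_def)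
  finally show False by simp
qed

theorem proposition6p7:
  "(\<forall>B. interpolating_blaschke_product B \<longrightarrow> WEP B) \<and>
   (\<exists>B. interpolating_blaschke_product B \<and> WEP B \<and> \<not> SIP B)"
  using interpolating_blaschke_product_WEP interpolating_node_blaschke not_SIP_node_blaschke by blast

end
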